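(* Let $n\ge 4$ and $1\le m\le\lfloor n/2\rfloor$. Consider the map $\varphi\colon L(\mathbf{A}_{n-2}^{(m)})\to L(\mathbf{D}_n^{(m)})$, $\varphi(a_1,\dots,a_{n-2})=(a_1,\dots,a_{n-2},0,0)$. Then the induced map on orbits $\varphi_*\colon \mathrm{Orb}(\mathbf{A}_{n-2}^{(m)})\to\mathrm{Orb}(\mathbf{D}_n^{(m)})$ is (well defined and) injective, and its image is the whole set $\mathrm{Orb}(\mathbf{D}_n^{(m)})$ except for the (one-element) orbits of the fixed labelings $\ell_1^{(m)}$, $\ell_3^{(m)}$ and $\ell_4^{(m)}$ when they occur, that is, except for the orbit of $\ell_4^{(m)}$ when $m$ is even and the orbits of $\ell_1^{(m)}$ and $\ell_3^{(m)}$ when $n-m$ is even.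
   Context: $\mathbf{A}_{n-2}^{(m)}$ denotes the path graph with vertices $1,\dots,n-2$ (edges $\{i,i+1\}$) with vertex $m$ colored black. $\mathbf{D}_n^{(m)}$ denotes the Dynkin diagram $\mathbf{D}_n$ with vertices $1,\dots,n$, edges $\{i,i+1\}$ for $1\le i\le n-2$ and the edge $\{n-2,n\}$, with vertex $m$ colored black. (So $n-2$ has neighbors $n-3,n-1,n$.) For such a graph with black vertex $m$, a labeling is a family $\boldsymbol a=(a_i)$ of elements of $\mathbb{Z}/2\mathbb{Z}$ indexed by the vertices; the set of labelings is denoted by $L(\cdot)$. For each vertex $i$ the move $\mathcal{M}_i$ changes only the coordinate $a_i$, replacing it by $a_i+\sum_{k\text{ neighbor of }i}a_k$ if $i\neq m$, and by $a_i+1+\sum_{k\text{ neighbor of }i}a_k$ if $i=m$. Two labelings are equivalent if they are related by a finite sequence of moves; $\mathrm{Orb}(\cdot)$ is the set of equivalence classes (orbits). A fixed labeling is one fixed by all moves. Labelings of $\mathbf{D}_n^{(m)}$: - if $m$ is even, $\ell_4^{(m)}$ has $a_1=a_3=\dots=a_{m-1}=1$, $a_{n-1}=a_n=1$, and all other $a_i=0$; - if $n-m$ is even, $\ell_1^{(m)}$ has $a_{m+1}=a_{m+3}=\dots=a_{n-3}=a_{n-1}=1$ and all other $a_i=0$; and $\ell_3^{(m)}$ has $a_{m+1}=a_{m+3}=\dots=a_{n-3}=1$, $a_n=1$ and all other $a_i=0$ (for $n-m=2$ only $a_{n-1}=1$, respectively only $a_n=1$). These are fixed labelings of $\mathbf{D}_n^{(m)}$.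 *)

theory Defs
  imports Main "HOL-Library.Z2" "HOL-Library.FuncSet"
begin

text \<open>Edges are unordered pairs, i.e. two-element sets of vertices.\<close>

record bw_graph =
  verts :: "nat set"
  edges :: "nat set set"
  black :: nat

definition neighbors :: "bw_graph \<Rightarrow> nat \<Rightarrow> nat set" where
  "neighbors G i = {k \<in> verts G. {i, k} \<in> edges G}"

text \<open>The type \<^typ>\<open>bit\<close> is the field with two elements. Labelings are extensional functions,
  so that two labelings are equal iff they agree on all vertices.\<close>

definition labelings :: "bw_graph \<Rightarrow> (nat \<Rightarrow> bit) set" where
  "labelings G = (verts G \<rightarrow>\<^sub>E UNIV)"

definition move :: "bw_graph \<Rightarrow> nat \<Rightarrow> (nat \<Rightarrow> bit) \<Rightarrow> (nat \<Rightarrow> bit)" where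
  "move G i a =
     a(i := (if i = black G then a i + 1 + (\<Sum>k\<in>neighbors G i. a k)
             else a i + (\<Sum>k\<in>neighbors G i. a k)))"

definition move_equiv :: "bw_graph \<Rightarrow> ((nat \<Rightarrow> bit) \<times> (nat \<Rightarrow> bit)) set" where
  "move_equiv G =
     {(a, b). a \<in> labelings G \<and> b \<in> labelings G \<and>
              (\<exists>vs. set vs \<subseteq> verts G \<and> b = fold (move G) vs a)}"

definition orbit_of :: "bw_graph \<Rightarrow> (nat \<Rightarrow> bit) \<Rightarrow> (nat \<Rightarrow> bit) set" where
  "orbit_of G a = move_equiv G `` {a}"

definition Orb :: "bw_graph \<Rightarrow> (nat \<Rightarrow> bit) set set" where
  "Orb G = labelings G // move_equiv G"

definition fixed_labeling :: "bw_graph \<Rightarrow> (nat \<Rightarrow> bit) \<Rightarrow> bool" where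
  "fixed_labeling G a \<longleftrightarrow> a \<in> labelings G \<and> (\<forall>i\<in>verts G. move G i a = a)"

definition A_graph :: "nat \<Rightarrow> nat \<Rightarrow> bw_graph" where
  "A_graph N m = \<lparr>verts = {1..N}, edges = {{i, i + 1} |i. 1 \<le> i \<and> i + 1 \<le> N}, black = m\<rparr>"

definition D_graph :: "nat \<Rightarrow> nat \<Rightarrow> bw_graph" where
  "D_graph n m =
     \<lparr>verts = {1..n}, edges = {{i, i + 1} |i. 1 \<le> i \<and> i \<le> n - 2} \<union> {{n - 2, n}}, black = m\<rparr>"

definition ell1 :: "nat \<Rightarrow> nat \<Rightarrow> nat \<Rightarrow> bit" where
  "ell1 n m = (\<lambda>i\<in>{1..n}. if m < i \<and> i \<le> n - 1 \<and> odd (i - m) then 1 else 0)"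

definition ell3 :: "nat \<Rightarrow> nat \<Rightarrow> nat \<Rightarrow> bit" where
  "ell3 n m = (\<lambda>i\<in>{1..n}. if (m < i \<and> i \<le> n - 3 \<and> odd (i - m)) \<or> i = n then 1 else 0)"

definition ell4 :: "nat \<Rightarrow> nat \<Rightarrow> nat \<Rightarrow> bit" where
  "ell4 n m = (\<lambda>i\<in>{1..n}. if (i \<le> m - 1 \<and> odd i) \<or> i = n - 1 \<or> i = n then 1 else 0)"

definition phi :: "nat \<Rightarrow> (nat \<Rightarrow> bit) \<Rightarrow> (nat \<Rightarrow> bit)" where
  "phi n a = (\<lambda>i\<in>{1..n}. if i \<le> n - 2 then a i else 0)"

text \<open>The map on orbits induced by a map \<open>f\<close> of labelings, in the usual form of a function on a
  quotient. It sends the orbit of \<open>a\<close> to the orbit of \<open>f a\<close> provided that the function sending \<open>a\<close>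
  to the orbit of \<open>f a\<close> respects \<^term>\<open>move_equiv G\<close>.\<close>

definition induced_map ::
  "bw_graph \<Rightarrow> ((nat \<Rightarrow> bit) \<Rightarrow> (nat \<Rightarrow> bit)) \<Rightarrow> (nat \<Rightarrow> bit) set \<Rightarrow> (nat \<Rightarrow> bit) set" where
  "induced_map H f X = (\<Union>a\<in>X. orbit_of H (f a))"

lemma move_labelings: "a \<in> labelings G \<Longrightarrow> i \<in> verts G \<Longrightarrow> move G i a \<in> labelings G"
  by (auto simp: labelings_def move_def PiE_def extensional_def)

lemma fold_move_labelings:
  "a \<in> labelings G \<Longrightarrow> set vs \<subseteq> verts G \<Longrightarrow> fold (move G) vs a \<in> labelings G"
  by (induction vs arbitrary: a) (auto simp: move_labelings)

lemma move_move:
  assumes "{i} \<notin> edges G"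
  shows "move G i (move G i a) = a"
proof -
  have "i \<notin> neighbors G i"
    using assms by (simp add: neighbors_def)
  then have *: "(\<Sum>k\<in>neighbors G i. (a(i := x)) k) = (\<Sum>k\<in>neighbors G i. a k)" for x
    by (intro sum.cong) auto
  have "x + y + y = x" "x + 1 + y + 1 + y = x" for x y :: bit
    by (cases x; cases y; simp)+
  then show ?thesis
    unfolding move_def * by (auto simp: fun_eq_iff)
qed

lemma equiv_move_equiv:
  assumes "\<And>i. {i} \<notin> edges G"
  shows "equiv (labelings G) (move_equiv G)"
proof (rule equivI)
  show "move_equiv G \<subseteq> labelings G \<times> labelings G"
    by (auto simp: move_equiv_def)
  show "refl_on (labelings G) (move_equiv G)"
    by (auto simp: refl_on_def move_equiv_def intro: exI[of _ "[]"])
  have rev: "fold (move G) (rev vs) (fold (move G) vs a) = a" for vs a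
    by (induction vs arbitrary: a) (simp_all add: move_move assms)
  show "sym (move_equiv G)"
    unfolding sym_def move_equiv_def using rev by (auto, metis set_rev)
  show "trans (move_equiv G)"
  proof (rule transI)
    fix a b c assume "(a, b) \<in> move_equiv G" "(b, c) \<in> move_equiv G"
    then obtain vs ws where "set vs \<subseteq> verts G" "b = fold (move G) vs a"
      "set ws \<subseteq> verts G" "c = fold (move G) ws b" "a \<in> labelings G" "c \<in> labelings G"
      by (auto simp: move_equiv_def)
    then show "(a, c) \<in> move_equiv G"
      by (auto simp: move_equiv_def intro!: exI[of _ "vs @ ws"])
  qed
qed

lemma equiv_A_graph: "equiv (labelings (A_graph N m)) (move_equiv (A_graph N m))"
  by (rule equiv_move_equiv) (auto simp: A_graph_def doubleton_eq_iff singleton_insert_inj_eq)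

lemma equiv_D_graph:
  assumes "n \<ge> 4"
  shows "equiv (labelings (D_graph n m)) (move_equiv (D_graph n m))"
  using assms
  by (intro equiv_move_equiv) (auto simp: D_graph_def singleton_insert_inj_eq)

end

theory Submission
  imports Defs "HOL-Combinatorics.Transposition"
begin

text \<open>
  The labelings of \<open>D\<^sub>n\<close> with black vertex \<open>m\<close> are the coset \<open>(\<omega>\<^sub>m + Q)/2Q\<close>, with \<open>Q\<close> the root
  lattice and \<open>\<omega>\<^sub>m\<close> a fundamental weight, and the moves are the simple reflections. In the standard
  coordinates, an element is given by its coordinates modulo 2, whose sum is \<open>m\<close>, and one further
  bit. The Weyl group permutes the coordinates and changes an even number of signs. A change of the
  signs of two coordinates of different parity flips the further bit, while between coordinates
  of equal parity it does nothing. So the number \<open>w\<close> of odd coordinates classifies the orbits if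
  \<open>0 < w < n\<close>, and for each of \<open>w = 0\<close> and \<open>w = n\<close> there are two fixed points. On the subdiagram
  \<open>A\<^sub>n\<^sub>-\<^sub>2\<close> only the first \<open>n - 1\<close> coordinates occur and \<open>w\<close> is a complete invariant. Hence the orbits
  missed by \<open>phi\<close> are both fixed points with \<open>w = n\<close> and the one with \<open>w = 0\<close> and nonzero bit.
\<close>

section \<open>Preliminaries on paths, sets of positions and orbits\<close>

lemma path_edge_iff:
  fixes i k N :: nat
  shows "{i, k} \<in> {{j, j + 1} |j. 1 \<le> j \<and> j < N} \<longleftrightarrow>
    (k = i + 1 \<or> i = k + 1) \<and> i \<in> {1..N} \<and> k \<in> {1..N}"
  by (auto simp: doubleton_eq_iff)

text \<open>Recognizes the end state of the sorting below: no free position directly precedes an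
  occupied one.\<close>

lemma downward_closed_eq_atLeastAtMost:
  fixes S :: "nat set"
  assumes "finite S" "0 \<notin> S" "\<And>i. 1 \<le> i \<Longrightarrow> i + 1 \<in> S \<Longrightarrow> i \<in> S"
  shows "S = {1..card S}"
proof (cases "S = {}")
  case False
  have up: "i \<in> S" if "i \<le> Max S" "1 \<le> i" for i
    using that
  proof (induction rule: inc_induct)
    case base then show ?case using False assms by simp
  next
    case (step i) then show ?case using assms(3)[of i] by simp
  qed
  have pos: "1 \<le> i" if "i \<in> S" for i
    using assms(2) that by (cases i) auto
  have eq: "S = {1..Max S}"
  proof (intro equalityI subsetI)
    fix i assume "i \<in> S"
    then show "i \<in> {1..Max S}" using pos[of i] Max_ge[OF assms(1), of i] by simp
  qed (simp add: up)
  have "card S = Max S"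
    using arg_cong[OF eq, of card] by simp
  then show ?thesis
    using eq by (simp only:)
qed simp

lemma orbit_fixed:
  assumes "fixed_labeling G a"
  shows "orbit_of G a = {a}"
proof -
  have "set vs \<subseteq> verts G \<Longrightarrow> fold (move G) vs a = a" for vs
    using assms by (induction vs) (auto simp: fixed_labeling_def)
  then show ?thesis
    using assms by (auto simp: orbit_of_def move_equiv_def fixed_labeling_def intro!: exI[of _ "[]"])
qed

lemma Orb_eq: "Orb G = orbit_of G ` labelings G"
  by (auto simp: Orb_def quotient_def orbit_of_def)

section \<open>The two diagrams and the coordinates modulo 2\<close>

locale forked_puzzle =
  fixes n m :: nat
  assumes n4: "4 \<le> n" and m1: "1 \<le> m" and mn: "m \<le> n - 2"
begin

abbreviation D :: bw_graph where "D \<equiv> D_graph n m"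
abbreviation A :: bw_graph where "A \<equiv> A_graph (n - 2) m"

text \<open>Modulo 2 the simple roots \<open>e\<^sub>n\<^sub>-\<^sub>1 - e\<^sub>n\<close> and \<open>e\<^sub>n\<^sub>-\<^sub>1 + e\<^sub>n\<close> agree, so only \<open>a\<^sub>n\<^sub>-\<^sub>1 + a\<^sub>n\<close> matters for the
  coordinates of \<open>\<omega>\<^sub>m + \<Sum>\<^sub>i a\<^sub>i \<alpha>\<^sub>i\<close>; the lost bit is \<open>a\<^sub>n\<close>.\<close>

definition collapse :: "(nat \<Rightarrow> bit) \<Rightarrow> nat \<Rightarrow> bit" where
  "collapse a k = (if k = 0 \<or> n \<le> k then 0 else if k = n - 1 then a (n - 1) + a n else a k)"

text \<open>The fundamental weight is odd at the first \<open>m\<close> positions, and for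
  \<open>j < n\<close> the \<open>j\<close>-th simple root meets positions \<open>j\<close> and
  \<open>j + 1\<close>. The zeros of \<open>collapse\<close> at \<open>0\<close> and
  \<open>n\<close> cover both ends.\<close>

definition coord :: "(nat \<Rightarrow> bit) \<Rightarrow> nat \<Rightarrow> bit" where
  "coord a j = of_bool (j \<le> m) + collapse a j + collapse a (j - 1)"

definition supp :: "(nat \<Rightarrow> bit) \<Rightarrow> nat set" where
  "supp a = {j \<in> {1..n}. coord a j = 1}"

lemma D_simps [simp]: "verts D = {1..n}" "black D = m"
  by (simp_all add: D_graph_def)

lemma A_simps [simp]: "verts A = {1..n - 2}" "black A = m"
  by (simp_all add: A_graph_def)

lemma neighbors_D:
  assumes "i \<in> {1..n}"
  shows "neighbors D i = (if i < n - 2 then {i - 1, i + 1} - {0}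
     else if i = n - 2 then {n - 3, n - 1, n} else {n - 2})"
proof (intro set_eqI)
  fix k
  have "edges D = {{j, j + 1} |j. 1 \<le> j \<and> j < n - 1} \<union> {{n - 2, n}}"
    unfolding D_graph_def bw_graph.simps using n4
    by (intro arg_cong2[where f = "(\<union>)"] Collect_cong refl) force
  then have "{i, k} \<in> edges D \<longleftrightarrow> (k = i + 1 \<or> i = k + 1) \<and> i \<in> {1..n - 1} \<and> k \<in> {1..n - 1} \<or>
      i = n - 2 \<and> k = n \<or> i = n \<and> k = n - 2"
    by (simp only: Un_iff path_edge_iff singleton_iff doubleton_eq_iff)
  then have iff: "k \<in> neighbors D i \<longleftrightarrow> k \<in> {1..n} \<and>
    ((k = i + 1 \<or> i = k + 1) \<and> i \<in> {1..n - 1} \<and> k \<in> {1..n - 1} \<or>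
      i = n - 2 \<and> k = n \<or> i = n \<and> k = n - 2)"
    by (simp only: neighbors_def mem_Collect_eq D_simps)
  \<comment> \<open>This substitution removes the truncated subtractions from the case
    analysis.\<close>
  obtain p j where "n = p + 4" "i = Suc j"
    using assms n4
    by (metis add.commute le_Suc_ex atLeastAtMost_iff One_nat_def Suc_le_D)
  then show "k \<in> neighbors D i \<longleftrightarrow> k \<in> (if i < n - 2 then {i - 1, i + 1} - {0}
     else if i = n - 2 then {n - 3, n - 1, n} else {n - 2})"
    unfolding iff using assms by (auto split: if_splits)
qed

lemma neighbors_A:
  assumes "i \<in> {1..n - 2}"
  shows "neighbors A i = (if i < n - 2 then {i - 1, i + 1} - {0} else {n - 3})"
proof (intro set_eqI)
  fix k
  have "edges A = {{j, j + 1} |j. 1 \<le> j \<and> j < n - 2}"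
    unfolding A_graph_def bw_graph.simps by (intro Collect_cong) force
  then have "{i, k} \<in> edges A \<longleftrightarrow> (k = i + 1 \<or> i = k + 1) \<and> i \<in> {1..n - 2} \<and> k \<in> {1..n - 2}"
    by (simp only: path_edge_iff)
  then have iff: "k \<in> neighbors A i \<longleftrightarrow> (k = i + 1 \<or> i = k + 1) \<and> k \<in> {1..n - 2}"
    using assms by (auto simp only: neighbors_def mem_Collect_eq A_simps)
  obtain p j where "n = p + 4" "i = Suc j"
    using assms n4
    by (metis add.commute le_Suc_ex atLeastAtMost_iff One_nat_def Suc_le_D)
  then show "k \<in> neighbors A i \<longleftrightarrow> k \<in> (if i < n - 2 then {i - 1, i + 1} - {0} else {n - 3})"
    unfolding iff using assms by (auto split: if_splits)
qed

section \<open>Moves as transpositions of coordinates\<close>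

lemma collapse_simps [simp]:
  "collapse a 0 = 0" "collapse a n = 0" "collapse a (n - Suc 0) = a (n - Suc 0) + a n"
  "0 < k \<Longrightarrow> k \<le> n - 2 \<Longrightarrow> collapse a k = a k"
  using n4 by (auto simp: collapse_def)

lemma coord_last: "coord a n = a (n - 1) + a n"
proof -
  have "\<not> n \<le> m" using n4 mn by simp
  then show ?thesis by (simp add: coord_def)
qed

text \<open>Merging the tips \<open>n - 1\<close> and \<open>n\<close> of the fork turns the diagram
  into a path with last vertex \<open>n - 1\<close>; \<open>collapse\<close> vanishes beyond both of
  its ends.\<close>

lemma sum_neighbors_D:
  assumes "i \<in> {1..n}"
  shows "(\<Sum>k\<in>neighbors D i. a k) =
    (let j = min i (n - 1) in collapse a (j - 1) + collapse a (j + 1))"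
proof -
  consider "i = 1" | "1 < i" "i < n - 2" | "i = n - 2" | "i = n - 1" | "i = n"
    using assms by fastforce
  then show ?thesis
  proof cases
    case 1
    moreover have "1 < n - 2" "1 \<le> n - 1"
      using n4 by auto
    ultimately show ?thesis
      by (simp add: neighbors_D insert_Diff_if min_absorb1)
  next
    case 3
    moreover have "n - 2 - 1 = n - 3" "n - 2 + 1 = n - 1" "n - 3 \<noteq> n - 1" "n - 3 \<noteq> n" "n - 1 \<noteq> n"
      "0 < n - 3" "n - 3 \<le> n - 2"
      using n4 by auto
    ultimately show ?thesis
      using assms n4 by (simp add: neighbors_D min_def)
  next
    case 4
    moreover have "n - 1 - 1 = n - 2" "n - 1 + 1 = n" "n - 1 \<noteq> n - 2" "\<not> n - 1 < n - 2"
      using n4 by auto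
    ultimately show ?thesis
      using assms n4 by (simp add: neighbors_D)
  next
    case 5
    moreover have "n - 1 - 1 = n - 2" "n - 1 + 1 = n" "min n (n - 1) = n - 1"
      "n \<noteq> n - 2" "\<not> n < n - 2"
      using n4 by auto
    ultimately show ?thesis
      using assms n4 by (simp add: neighbors_D)
  qed (use n4 in \<open>simp_all add: neighbors_D insert_Diff_if min_absorb1\<close>)
qed

text \<open>The shared term \<open>collapse a j\<close> cancels, which leaves exactly the increment
  made by a move at path position \<open>j\<close>.\<close>

lemma coord_add_coord_Suc:
  "coord a j + coord a (j + 1) = of_bool (j = m) + (collapse a (j - 1) + collapse a (j + 1))"
proof -
  have "x + f + g + (y + h + f) = (x + y) + (g + h)" for x y f g h :: bit
    by (cases x; cases y; cases f; cases g; cases h; simp)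
  moreover have "of_bool (j \<le> m) + of_bool (j + 1 \<le> m) = (of_bool (j = m) :: bit)"
    by auto
  ultimately show ?thesis
    by (simp only: coord_def add_diff_cancel_right')
qed

lemma move_D:
  assumes "i \<in> {1..n}"
  shows "move D i a = (let j = min i (n - 1) in a(i := a i + (coord a j + coord a (j + 1))))"
proof -
  \<comment> \<open>As \<open>m \<le> n - 2\<close>, the black vertex is not a tip, so merging the
    tips does not affect it.\<close>
  have "min i (n - 1) = m \<longleftrightarrow> i = m"
    using n4 mn by (auto simp: min_def)
  then show ?thesis
    using assms
    by (cases "i = m") (simp_all only: move_def sum_neighbors_D coord_add_coord_Suc Let_def D_simps
      of_bool_eq if_True if_False add_0_left add.assoc simp_thms)
qed

lemma collapse_upd:
  assumes "i \<in> {1..n}" "j = min i (n - 1)"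
  shows "collapse (a(i := a i + x)) = (collapse a)(j := collapse a j + x)"
  using assms n4 by (auto simp: collapse_def fun_eq_iff ac_simps min_def)

text \<open>A move adds the sum of coordinates \<open>j\<close> and \<open>j + 1\<close> to both of
  them, which in characteristic 2 exchanges them. The sign changes made by the reflection at
  \<open>n\<close> are invisible modulo 2.\<close>

lemma coord_move:
  assumes "i \<in> {1..n}" "j = min i (n - 1)" "k \<in> {1..n}"
  shows "coord (move D i a) k = coord a (transpose j (j + 1) k)"
proof -
  define d where "d = coord a j + coord a (j + 1)"
  have "1 \<le> j" using assms n4 by auto
  have "collapse (move D i a) = (collapse a)(j := collapse a j + d)"
    unfolding move_D[OF assms(1)] Let_def assms(2) [symmetric] d_def
    by (rule collapse_upd) (use assms in auto)
  then have "coord (move D i a) k = coord a k + (if k = j \<or> k = j + 1 then d else 0)"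
    using \<open>1 \<le> j\<close> assms(3) by (auto simp only: coord_def fun_upd_apply ac_simps add_0_left split: if_split)
  moreover have "x + (x + y) = y" "x + (y + x) = y" for x y :: bit
    by (cases x; simp)+
  ultimately show ?thesis
    by (simp only: d_def transpose_def) simp
qed

section \<open>The set of odd coordinates, its invariance and its parity\<close>

lemma finite_supp [simp]: "finite (supp a)" and supp_subset: "supp a \<subseteq> {1..n}"
  by (auto simp: supp_def)

lemma supp_move:
  assumes "i \<in> {1..n}" "j = min i (n - 1)"
  shows "supp (move D i a) = transpose j (j + 1) ` supp a"
proof -
  have "transpose j (j + 1) k \<in> {1..n} \<longleftrightarrow> k \<in> {1..n}" for k
    using assms n4 by (auto simp: transpose_def)
  then show ?thesis
    using coord_move[OF assms]
    by (auto simp: supp_def in_transpose_image_iff)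
qed

lemma card_supp_move: "i \<in> {1..n} \<Longrightarrow> card (supp (move D i a)) = card (supp a)"
  by (simp add: supp_move card_image)

lemma card_supp_equiv: "(a, b) \<in> move_equiv D \<Longrightarrow> card (supp a) = card (supp b)"
proof -
  have "set vs \<subseteq> {1..n} \<Longrightarrow> card (supp (fold (move D) vs a)) = card (supp a)" for vs
    by (induction vs arbitrary: a) (auto simp: card_supp_move)
  then show "(a, b) \<in> move_equiv D \<Longrightarrow> card (supp a) = card (supp b)"
    by (auto simp: move_equiv_def)
qed

text \<open>Since \<open>collapse\<close> starts at zero, the coordinates determine it step by step;
  the bit at \<open>n\<close> then separates the two tips.\<close>

lemma labeling_eqI:
  assumes "a \<in> labelings D" "b \<in> labelings D" "supp a = supp b" "a n = b n"
  shows "a = b"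
proof -
  have coord: "coord a k = coord b k" if "k \<in> {1..n}" for k
  proof -
    have "k \<in> supp a \<longleftrightarrow> k \<in> supp b" using assms(3) by simp
    then show ?thesis
      using that by (cases "coord a k"; cases "coord b k") (auto simp: supp_def)
  qed
  have ends: "k \<le> n \<Longrightarrow> collapse a k = collapse b k" for k
  proof (induction k)
    case (Suc k)
    then have "coord a (Suc k) = coord b (Suc k)" "collapse a k = collapse b k"
      using coord[of "Suc k"] by auto
    then show ?case
      by (simp only: coord_def diff_Suc_1 add_left_cancel add_right_cancel)
  qed (simp add: collapse_def)
  have "a k = b k" for k
  proof -
    consider "k \<notin> {1..n}" | "k = n" | "k = n - 1" | "1 \<le> k" "k < n - 1" by fastforce
    then show ?thesis
    proof cases
      case 1
      then show ?thesis using assms(1,2) by (metis D_simps(1) PiE_arb labelings_def)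
    next
      case 3
      have "collapse a (n - 1) = collapse b (n - 1)" by (rule ends) simp
      then have "a (n - 1) + a n = b (n - 1) + b n"
        by (simp only: collapse_simps One_nat_def)
      then show ?thesis using 3 assms(4) by (simp only: add_right_cancel)
    next
      case 4
      then have "0 < k" "k \<le> n - 2" "k \<le> n" by auto
      then show ?thesis using ends[of k] by simp
    qed (use assms(4) in simp)
  qed
  then show ?thesis by auto
qed

text \<open>The coordinate sum telescopes: each interior value of \<open>collapse\<close> occurs
  twice. So an empty support forces \<open>m\<close> to be even, and a full one forces
  \<open>n - m\<close> to be even.\<close>

lemma parity_supp: "even (card (supp a)) \<longleftrightarrow> even m"
proof -
  have *: "k \<le> n \<Longrightarrow> (\<Sum>j\<in>{1..k}. coord a j) = of_nat (min k m) + collapse a k" for k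
  proof (induction k)
    case (Suc k)
    have min: "of_nat (min (Suc k) m) = of_nat (min k m) + (of_bool (Suc k \<le> m) :: bit)"
      by (cases "Suc k \<le> m") (simp_all add: min_absorb1 min_absorb2)
    have sum: "(\<Sum>j\<in>{1..Suc k}. coord a j) =
        of_nat (min k m) + collapse a k + coord a (Suc k)"
      using Suc by simp
    have cancel: "x + y + (z + w + y) = x + z + w" for x y z w :: bit
      by (cases y) (auto simp: ac_simps)
    show ?case
      by (simp only: sum min coord_def[of a "Suc k"] diff_Suc_1 cancel)
  qed (simp add: collapse_def)
  have "of_nat (card (supp a)) = (\<Sum>j\<in>{1..n}. of_bool (coord a j = 1) :: bit)"
    by (simp add: supp_def Int_def)
  also have "\<dots> = (\<Sum>j\<in>{1..n}. coord a j)"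
  proof -
    have "of_bool (x = 1) = x" for x :: bit
      by (cases x) simp_all
    then show ?thesis by (simp only:)
  qed
  also have "\<dots> = of_nat m"
    using *[of n] mn by (simp add: collapse_def)
  finally show ?thesis
    by (metis even_of_nat_iff)
qed

section \<open>Normal forms under moves\<close>

text \<open>Bubble sort by adjacent transpositions. Vertex \<open>n\<close> is never moved, so its
  bit survives; with \<open>k = n - 1\<close> all moves stay inside \<open>A\<close>.\<close>

lemma sort_supp:
  assumes "supp a \<subseteq> {1..k}" "k \<le> n"
  obtains vs where "set vs \<subseteq> {1..<k}" "supp (fold (move D) vs a) = {1..card (supp a)}"
    "fold (move D) vs a n = a n"
proof -
  have "\<exists>vs. set vs \<subseteq> {1..<k} \<and> supp (fold (move D) vs a) = {1..card (supp a)} \<and>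
    fold (move D) vs a n = a n"
    using assms
  \<comment> \<open>Moving an odd coordinate from \<open>i + 1\<close> to a free position
    \<open>i\<close> lowers the sum of the positions.\<close>
  proof (induction "\<Sum>(supp a)" arbitrary: a rule: less_induct)
    case (less a)
    show ?case
    proof (cases "\<exists>i\<ge>1. i \<notin> supp a \<and> i + 1 \<in> supp a")
      case True
      then obtain i where i: "1 \<le> i" "i \<notin> supp a" "i + 1 \<in> supp a" by blast
      then have ik: "i < k" using less.prems by auto
      define b where "b = move D i a"
      have "supp b = transpose i (i + 1) ` supp a"
        unfolding b_def using i ik less.prems by (subst supp_move) auto
      also have "\<dots> = insert i (supp a - {i + 1})"
        using i by (auto simp: in_transpose_image_iff transpose_def split: if_splits)
      finally have supp_b: "supp b = insert i (supp a - {i + 1})" .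
      have "\<Sum>(supp b) < \<Sum>(supp a)"
        using i by (simp add: supp_b sum.remove[of "supp a" "i + 1"])
      moreover have "supp b \<subseteq> {1..k}"
        using supp_b less.prems i ik by auto
      ultimately obtain vs where vs: "set vs \<subseteq> {1..<k}"
        "supp (fold (move D) vs b) = {1..card (supp b)}" "fold (move D) vs b n = b n"
        using less.hyps less.prems by blast
      have "b n = a n" "card (supp b) = card (supp a)"
        unfolding b_def using i ik less.prems
        by (simp add: move_def, intro card_supp_move) auto
      then show ?thesis
        using vs i ik by (intro exI[of _ "i # vs"]) (auto simp: b_def)
    next
      case False
      then have "supp a = {1..card (supp a)}"
        using supp_subset[of a] by (intro downward_closed_eq_atLeastAtMost) auto
      then show ?thesis by (intro exI[of _ "[]"] conjI) simp_all
    qed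
  qed
  then show ?thesis using that by blast
qed

text \<open>Some two adjacent coordinates differ. Such a pair can be pushed to positions
  \<open>n - 1\<close> and \<open>n\<close>, where the move at \<open>n\<close> flips the last
  bit.\<close>

lemma clear_last:
  assumes "supp a \<noteq> {}" "supp a \<noteq> {1..n}"
  obtains vs where "set vs \<subseteq> {1..n}" "fold (move D) vs a n = 0"
proof -
  have "\<exists>i\<in>{1..<n}. coord a i \<noteq> coord a (i + 1)"
  proof (rule ccontr)
    assume const: "\<not> ?thesis"
    define x where "x = coord a 1"
    have "j \<le> n \<Longrightarrow> coord a j = x" if "1 \<le> j" for j
      using that
    proof (induction rule: dec_induct)
      case (step j)
      then have "j \<in> {1..<n}" "coord a j = x" by auto
      moreover from this have "coord a j = coord a (j + 1)" using const by blast
      ultimately show ?case by simp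
    qed (simp add: x_def)
    then have "supp a = (if x = 1 then {1..n} else {})"
      unfolding supp_def by auto
    then show False
      using assms by (metis (full_types))
  qed
  then obtain i where i: "i \<in> {1..<n}" and neq: "coord a i \<noteq> coord a (i + 1)"
    by blast
  have "i \<le> n - 1" "1 \<le> i"
    using i by auto
  then have "\<exists>vs. set vs \<subseteq> {1..n} \<and> fold (move D) vs a n = 0"
    using neq
  proof (induction arbitrary: a rule: inc_induct)
    case (base a)
    show ?case
    proof (cases "a n = 0")
      case True then show ?thesis by (intro exI[of _ "[]"]) auto
    next
      case False
      then have "move D n a n = 0"
        using base n4 by (cases "coord a (n - 1)"; cases "coord a n") (auto simp: move_D)
      then show ?thesis using n4 by (intro exI[of _ "[n]"]) auto
    qed
  next
    case (step i a)
    show ?case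
    proof (cases "coord a (Suc i) = coord a (Suc i + 1)")
      case False then show ?thesis using step by auto
    next
      case True
      \<comment> \<open>Coordinates \<open>i + 1\<close> and \<open>i + 2\<close> agree and differ
        from coordinate \<open>i\<close>; swapping \<open>i\<close> and \<open>i + 1\<close> shifts
        the unequal pair one position to the right.\<close>
      define b where "b = move D i a"
      have "coord b (Suc i) = coord a i" "coord b (Suc i + 1) = coord a (Suc i + 1)"
        unfolding b_def using step by (subst coord_move[OF _ refl]; auto simp: transpose_def min_def)+
      then have "coord b (Suc i) \<noteq> coord b (Suc i + 1)" using True step by simp
      then obtain vs where "set vs \<subseteq> {1..n}" "fold (move D) vs b n = 0"
        using step by auto
      then show ?thesis using step by (intro exI[of _ "i # vs"]) (auto simp: b_def)
    qed
  qed
  then show ?thesis using that by blast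
qed

section \<open>The fixed labelings\<close>

text \<open>Every move adds the sum of two adjacent coordinates, and here all coordinates are
  equal.\<close>

lemma fixed_labelingI:
  assumes "a \<in> labelings D" "supp a = {} \<or> supp a = {1..n}"
  shows "fixed_labeling D a"
proof -
  have "move D i a = a" if i: "i \<in> {1..n}" for i
  proof -
    define j where "j = min i (n - 1)"
    have "1 \<le> j" "j < n" using i n4 by (auto simp: j_def)
    then have "j \<in> {1..n}" "j + 1 \<in> {1..n}" by auto
    then have "j \<in> supp a \<longleftrightarrow> j + 1 \<in> supp a" using assms(2) by (metis empty_iff)
    then have "coord a j = coord a (j + 1)"
      using \<open>1 \<le> j\<close> \<open>j < n\<close> by (cases "coord a j"; cases "coord a (j + 1)") (auto simp: supp_def)
    then have "coord a j + coord a (j + 1) = 0" by simp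
    then show ?thesis
      by (simp only: move_D[OF i] Let_def j_def [symmetric] add_0_right fun_upd_triv)
  qed
  then show ?thesis
    using assms(1) by (simp add: fixed_labeling_def)
qed

text \<open>Serves both \<open>ell1\<close> and \<open>ell3\<close>: they differ only by exchanging
  the tips, so they have the same \<open>collapse\<close>.\<close>

lemma supp_eq_full:
  assumes "even (n - m)" "\<And>k. collapse a k = of_bool (m < k \<and> k < n \<and> odd (k - m))"
  shows "supp a = {1..n}"
proof -
  have "coord a j = 1" if "j \<in> {1..n}" for j
  proof -
    consider "j \<le> m" | d where "j = Suc (m + d)"
      by (metis less_imp_Suc_add not_le)
    then show ?thesis
    proof cases
      case 1
      then have "\<not> m < j" "\<not> m < j - 1" by auto
      then show ?thesis using \<open>j \<le> m\<close> unfolding coord_def assms(2) by simp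
    next
      case 2
      \<comment> \<open>At \<open>j = n\<close> the cutoff \<open>k < n\<close> is harmless:
        \<open>d = n - m - 1\<close> is odd, so the alternating pattern is zero there
        anyway.\<close>
      then have "j < n \<or> odd d"
        using assms(1) that by (cases "j = n") auto
      moreover have "collapse a j = of_bool (j < n \<and> even d)"
        unfolding assms(2) using 2 by auto
      moreover have "collapse a (j - 1) = of_bool (odd d)"
        unfolding assms(2) using 2 that by (cases d) auto
      ultimately show ?thesis
        using 2 by (auto simp only: coord_def) auto
    qed
  qed
  then show ?thesis by (auto simp: supp_def)
qed

lemma ell4_props:
  assumes "even m"
  shows "ell4 n m \<in> labelings D" "supp (ell4 n m) = {}" "ell4 n m n = 1"
proof -
  \<comment> \<open>The ones at the two tips cancel.\<close>
  have "collapse (ell4 n m) k = of_bool (k < m \<and> odd k)" for k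
    using n4 mn m1 by (auto simp: collapse_def ell4_def)
  then have "coord (ell4 n m) j = 0" if "1 \<le> j" for j
    using that assms by (cases j m rule: linorder_cases) (auto simp: coord_def)
  then show "supp (ell4 n m) = {}"
    by (auto simp: supp_def)
qed (use n4 in \<open>auto simp: ell4_def labelings_def\<close>)

lemma ell1_props:
  assumes "even (n - m)"
  shows "ell1 n m \<in> labelings D" "supp (ell1 n m) = {1..n}" "ell1 n m n = 0" "ell1 n m (n - 1) = 1"
proof -
  have "collapse (ell1 n m) k = of_bool (m < k \<and> k < n \<and> odd (k - m))" for k
  proof -
    consider "k \<le> n - 3" | "k = n - 2" | "k = n - 1" | "n \<le> k" by linarith
    then show ?thesis
      using n4 mn assms by cases (auto simp: collapse_def ell1_def)
  qed
  then show "supp (ell1 n m) = {1..n}"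
    by (rule supp_eq_full[OF assms])
qed (use n4 mn assms in \<open>auto simp: ell1_def labelings_def\<close>)

lemma ell3_props:
  assumes "even (n - m)"
  shows "ell3 n m \<in> labelings D" "supp (ell3 n m) = {1..n}" "ell3 n m n = 1"
proof -
  have "collapse (ell3 n m) k = of_bool (m < k \<and> k < n \<and> odd (k - m))" for k
  proof -
    consider "k \<le> n - 3" | "k = n - 2" | "k = n - 1" | "n \<le> k" by linarith
    then show ?thesis
      using n4 mn assms by cases (auto simp: collapse_def ell3_def)
  qed
  then show "supp (ell3 n m) = {1..n}"
    by (rule supp_eq_full[OF assms])
qed (use n4 mn assms in \<open>auto simp: ell3_def labelings_def\<close>)

section \<open>The embedding of labelings and its compatibility with moves\<close>

lemma phi_labelings: "phi n a \<in> labelings D"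
  by (auto simp: phi_def labelings_def)

lemma phi_apply: "k \<in> {1..n - 2} \<Longrightarrow> phi n a k = a k"
  by (auto simp: phi_def)

lemma phi_ends: "phi n a n = 0" "phi n a (n - 1) = 0"
  using n4 by (auto simp: phi_def)

text \<open>Only vertex \<open>n - 2\<close> gains neighbours in \<open>D\<close>, and these carry
  zeros.\<close>

lemma phi_move:
  assumes "i \<in> {1..n - 2}"
  shows "phi n (move A i a) = move D i (phi n a)"
proof -
  consider "i = 1" "i < n - 2" | "1 < i" "i < n - 2" | "i = n - 2"
    using assms by fastforce
  then have "(\<Sum>k\<in>neighbors A i. a k) = (\<Sum>k\<in>neighbors D i. phi n a k)"
  proof cases
    case 3
    moreover have "n - 3 \<noteq> n - 1" "n - 3 \<noteq> n" "n - 1 \<noteq> n" "1 \<le> n - 3" "n - 3 \<le> n - 2" "n - 3 \<le> n"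
      "\<not> n - 1 \<le> n - 2" "\<not> n \<le> n - 2"
      using n4 by auto
    ultimately show ?thesis
      using assms by (simp add: neighbors_A neighbors_D phi_def)
  qed (use assms n4 in \<open>auto simp: neighbors_A neighbors_D phi_def insert_Diff_if\<close>)
  then show ?thesis
    using assms n4 by (auto simp: move_def phi_def fun_eq_iff)
qed

lemma phi_fold_move:
  "set vs \<subseteq> {1..n - 2} \<Longrightarrow> phi n (fold (move A) vs a) = fold (move D) vs (phi n a)"
  by (induction vs arbitrary: a) (auto simp: phi_move)

lemma phi_inject:
  assumes "a \<in> labelings A" "b \<in> labelings A" "phi n a = phi n b"
  shows "a = b"
proof
  fix k show "a k = b k"
    using assms(1,2) phi_apply[of k] fun_cong[OF assms(3), of k]
    by (cases "k \<in> {1..n - 2}") (auto simp: labelings_def PiE_def extensional_def)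
qed

lemma phi_restrict:
  assumes "a \<in> labelings D" "a (n - 1) = 0" "a n = 0"
  shows "phi n (restrict a {1..n - 2}) = a"
proof
  fix k
  have "k \<notin> {1..n} \<or> k = n \<or> k = n - 1 \<or> k \<in> {1..n - 2}" by auto
  then show "phi n (restrict a {1..n - 2}) k = a k"
    using assms n4 by (auto simp: phi_def labelings_def PiE_def extensional_def)
qed

lemma phi_equiv:
  assumes "(a, b) \<in> move_equiv A"
  shows "(phi n a, phi n b) \<in> move_equiv D"
proof -
  obtain vs where vs: "set vs \<subseteq> {1..n - 2}" "b = fold (move A) vs a"
    using assms by (auto simp: move_equiv_def)
  have "set vs \<subseteq> verts D"
    using vs(1) by (rule subset_trans) auto
  moreover have "phi n b = fold (move D) vs (phi n a)"
    unfolding vs(2) by (rule phi_fold_move[OF vs(1)])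
  ultimately show ?thesis
    using phi_labelings unfolding move_equiv_def by blast
qed

lemma supp_phi: "supp (phi n a) \<subseteq> {1..n - 1}"
proof -
  have "coord (phi n a) n = 0"
    using phi_ends[of a] by (simp add: coord_last)
  then have "n \<notin> supp (phi n a)" by (simp add: supp_def)
  show ?thesis
  proof
    fix k assume "k \<in> supp (phi n a)"
    then have "k \<in> {1..n}" "k \<noteq> n"
      using supp_subset \<open>n \<notin> supp (phi n a)\<close> by blast+
    then show "k \<in> {1..n - 1}" by auto
  qed
qed

text \<open>The core of injectivity: both labelings are sorted by moves of \<open>A\<close> alone.
  Equal numbers of odd coordinates and zero bits at \<open>n\<close> make the results equal in
  \<open>D\<close>, hence in \<open>A\<close>.\<close>

lemma phi_equivD:
  assumes a: "a \<in> labelings A" and b: "b \<in> labelings A"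
    and ab: "(phi n a, phi n b) \<in> move_equiv D"
  shows "(a, b) \<in> move_equiv A"
proof -
  obtain vs where vs: "set vs \<subseteq> {1..<n - 1}"
      "supp (fold (move D) vs (phi n a)) = {1..card (supp (phi n a))}"
      "fold (move D) vs (phi n a) n = phi n a n"
    using sort_supp[OF supp_phi] by auto
  obtain ws where ws: "set ws \<subseteq> {1..<n - 1}"
      "supp (fold (move D) ws (phi n b)) = {1..card (supp (phi n b))}"
      "fold (move D) ws (phi n b) n = phi n b n"
    using sort_supp[OF supp_phi] by auto
  have sub: "set vs \<subseteq> {1..n - 2}" "set ws \<subseteq> {1..n - 2}"
    using vs(1) ws(1) by fastforce+
  have lab: "fold (move A) vs a \<in> labelings A" "fold (move A) ws b \<in> labelings A"
    using a b sub by (auto intro!: fold_move_labelings)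
  have "fold (move D) vs (phi n a) = fold (move D) ws (phi n b)"
  proof (rule labeling_eqI)
    show "fold (move D) vs (phi n a) n = fold (move D) ws (phi n b) n"
      using vs(3) ws(3) by (simp add: phi_ends)
  qed (use vs ws sub card_supp_equiv[OF ab] phi_labelings in \<open>auto simp flip: phi_fold_move\<close>)
  then have "phi n (fold (move A) vs a) = phi n (fold (move A) ws b)"
    by (simp only: phi_fold_move sub)
  then have "fold (move A) vs a = fold (move A) ws b"
    by (rule phi_inject[OF lab])
  then have "(a, fold (move A) vs a) \<in> move_equiv A" "(b, fold (move A) vs a) \<in> move_equiv A"
    using a b lab sub unfolding move_equiv_def A_simps by blast+
  then show ?thesis
    using equiv_A_graph[of "n - 2" m] by (meson equivE symE transE)
qed

section \<open>The induced map on orbits\<close>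

lemma orbit_D_eq_iff:
  assumes "a \<in> labelings D" "b \<in> labelings D"
  shows "orbit_of D a = orbit_of D b \<longleftrightarrow> (a, b) \<in> move_equiv D"
  unfolding orbit_of_def using eq_equiv_class_iff[OF equiv_D_graph[OF n4] assms] .

lemma phi_respects: "(\<lambda>a. orbit_of D (phi n a)) respects move_equiv A"
  by (rule congruentI) (simp add: orbit_D_eq_iff phi_labelings phi_equiv)

lemma induced_map_orbit:
  assumes "a \<in> labelings A"
  shows "induced_map D (phi n) (orbit_of A a) = orbit_of D (phi n a)"
  unfolding induced_map_def orbit_of_def[of A]
  by (rule UN_equiv_class[OF equiv_A_graph phi_respects assms])

lemma inj_on_induced_map: "inj_on (induced_map D (phi n)) (Orb A)"
proof (rule inj_onI)
  fix X Y assume "X \<in> Orb A" "Y \<in> Orb A" and eq: "induced_map D (phi n) X = induced_map D (phi n) Y"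
  then obtain a b where ab: "a \<in> labelings A" "b \<in> labelings A" "X = orbit_of A a" "Y = orbit_of A b"
    by (auto simp: Orb_eq)
  then have "(phi n a, phi n b) \<in> move_equiv D"
    using eq by (simp add: induced_map_orbit orbit_D_eq_iff phi_labelings)
  then have "(a, b) \<in> move_equiv A" using ab phi_equivD by blast
  then show "X = Y"
    unfolding ab(3,4) orbit_of_def by (rule equiv_class_eq[OF equiv_A_graph])
qed

text \<open>First the bit at \<open>n\<close> is cleared, then the support is sorted without
  touching that bit. The result vanishes at both tips, so it comes from \<open>A\<close>.\<close>

lemma orbit_in_image:
  assumes a: "a \<in> labelings D" and full: "supp a \<noteq> {1..n}" and empty: "supp a = {} \<Longrightarrow> a n = 0"
  shows "orbit_of D a \<in> induced_map D (phi n) ` Orb A"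
proof -
  \<comment> \<open>With empty support no move changes anything, so the bit must already be
    zero.\<close>
  obtain vs where vs: "set vs \<subseteq> {1..n}" "fold (move D) vs a n = 0"
  proof (cases "supp a = {}")
    case True then show ?thesis using that[of "[]"] empty by simp
  next
    case False then show ?thesis using clear_last full that by blast
  qed
  define b where "b = fold (move D) vs a"
  obtain ws where ws: "set ws \<subseteq> {1..<n}" "supp (fold (move D) ws b) = {1..card (supp b)}"
    "fold (move D) ws b n = b n"
    using sort_supp[OF supp_subset order_refl] .
  define c where "c = fold (move D) ws b"
  have lab: "b \<in> labelings D" "c \<in> labelings D"
    unfolding b_def c_def using a vs ws by (auto intro!: fold_move_labelings)
  have ac: "(a, c) \<in> move_equiv D"
  proof -
    have "{1..<n} \<subseteq> {1..n}" by auto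
    then have "set (vs @ ws) \<subseteq> verts D"
      using vs(1) ws(1) unfolding set_append D_simps by blast
    moreover have "c = fold (move D) (vs @ ws) a"
      by (simp add: b_def c_def)
    ultimately show ?thesis
      using a lab(2) unfolding move_equiv_def by blast
  qed
  have "card (supp a) < n"
    using full supp_subset[of a] psubset_card_mono[of "{1..n}" "supp a"] by auto
  \<comment> \<open>Fewer than \<open>n\<close> odd coordinates, once sorted, leave position
    \<open>n\<close> even.\<close>
  then have "n \<notin> supp c"
    using card_supp_equiv[OF ac] ws by (auto simp: c_def)
  then have "coord c n = 0" using n4 by (simp add: supp_def)
  moreover have "c n = 0" using vs ws by (simp add: b_def c_def)
  ultimately have "c (n - 1) = 0"
    using coord_last[of c] by simp
  then have "phi n (restrict c {1..n - 2}) = c"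
    using lab \<open>c n = 0\<close> phi_restrict by blast
  moreover have "restrict c {1..n - 2} \<in> labelings A" by (auto simp: labelings_def)
  ultimately have "orbit_of D c \<in> induced_map D (phi n) ` Orb A"
    unfolding Orb_eq image_image by (metis image_eqI induced_map_orbit)
  then show ?thesis using ac a lab orbit_D_eq_iff by metis
qed

text \<open>A fixed labeling is alone in its orbit, whereas \<open>phi\<close> yields zeros at both
  tips.\<close>

lemma orbit_phi_neq_fixed:
  assumes "fixed_labeling D b" "b (n - 1) = 1 \<or> b n = 1"
  shows "orbit_of D (phi n a) \<noteq> orbit_of D b"
proof
  assume "orbit_of D (phi n a) = orbit_of D b"
  moreover have "phi n a \<in> orbit_of D (phi n a)"
    using phi_labelings[of a] by (auto simp: orbit_of_def move_equiv_def intro!: exI[of _ "[]"])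
  ultimately have "phi n a = b" using assms orbit_fixed by auto
  then show False using assms(2) phi_ends[of a] by auto
qed

lemmas fixed_ell4 = fixed_labelingI[OF ell4_props(1) disjI1[OF ell4_props(2)]]
lemmas fixed_ell1 = fixed_labelingI[OF ell1_props(1) disjI2[OF ell1_props(2)]]
lemmas fixed_ell3 = fixed_labelingI[OF ell3_props(1) disjI2[OF ell3_props(2)]]

lemma image_induced_map:
  "induced_map D (phi n) ` Orb A =
    Orb D - ((if even m then {orbit_of D (ell4 n m)} else {})
           \<union> (if even (n - m) then {orbit_of D (ell1 n m), orbit_of D (ell3 n m)} else {}))"
    (is "?I = Orb D - ?E")
proof (intro equalityI subsetI)
  fix X assume "X \<in> ?I"
  then obtain a where "X = orbit_of D (phi n a)" by (auto simp: Orb_eq induced_map_orbit)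
  then show "X \<in> Orb D - ?E"
    using phi_labelings[of a] orbit_phi_neq_fixed[of _ a] fixed_ell4 fixed_ell1 fixed_ell3
      ell4_props(3) ell1_props(4) ell3_props(3)
    by (auto simp: Orb_eq)
next
  fix X assume X: "X \<in> Orb D - ?E"
  then obtain a where a: "a \<in> labelings D" "X = orbit_of D a" by (auto simp: Orb_eq)
  have "supp a \<noteq> {1..n}"
  proof
    assume full: "supp a = {1..n}"
    then have ev: "even (n - m)" using parity_supp[of a] mn by auto
    \<comment> \<open>The bit at \<open>n\<close> decides between the two labelings with full
      support.\<close>
    have "a = ell1 n m \<or> a = ell3 n m"
      using labeling_eqI[OF a(1)] ell1_props[OF ev] ell3_props[OF ev] full
      by (cases "a n") auto
    then show False using X a ev by auto
  qed
  moreover have "a n = 0" if "supp a = {}"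
  proof (rule ccontr)
    assume "a n \<noteq> 0"
    moreover have ev: "even m" using parity_supp[of a] that by simp
    ultimately have "a = ell4 n m"
      using labeling_eqI[OF a(1)] ell4_props that by simp
    then show False using X a ev by auto
  qed
  ultimately show "X \<in> ?I" using orbit_in_image a by simp
qed

end

theorem theorem10p5:
  fixes n m :: nat
  assumes "n \<ge> 4" and "1 \<le> m" and "m \<le> n div 2"
  defines "A \<equiv> A_graph (n - 2) m"
    and "D \<equiv> D_graph n m"
  shows "phi n \<in> labelings A \<rightarrow> labelings D
    \<and> (\<lambda>a. orbit_of D (phi n a)) respects move_equiv A
    \<and> inj_on (induced_map D (phi n)) (Orb A)
    \<and> induced_map D (phi n) ` Orb A =
        Orb D - ((if even m then {orbit_of D (ell4 n m)} else {})
               \<union> (if even (n - m) then {orbit_of D (ell1 n m), orbit_of D (ell3 n m)} else {}))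
    \<and> (even m \<longrightarrow> fixed_labeling D (ell4 n m) \<and> orbit_of D (ell4 n m) = {ell4 n m})
    \<and> (even (n - m) \<longrightarrow>
         fixed_labeling D (ell1 n m) \<and> orbit_of D (ell1 n m) = {ell1 n m} \<and>
         fixed_labeling D (ell3 n m) \<and> orbit_of D (ell3 n m) = {ell3 n m})"
proof -
  \<comment> \<open>For \<open>n \<ge> 4\<close>, \<open>m \<le> n div 2\<close> gives
    \<open>m \<le> n - 2\<close>: the black vertex lies on the path \<open>A\<close>.\<close>
  interpret forked_puzzle n m
    by unfold_locales (use assms in auto)
  show ?thesis
    unfolding A_def D_def
    using phi_labelings phi_respects inj_on_induced_map image_induced_map
      fixed_ell4 fixed_ell1 fixed_ell3 orbit_fixed
    by blast
qed

end
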